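(* Let $G$ be a connected graph with at least $2$ vertices and $H$ a connected graph. Then \[F(G+_S H)=|V(H)|F(G)+|V(G)|F(H)+6|E(H)|M_1(G)+6|E(G)|M_1(H)+8|V(H)||E(G)|.\]
   Context: All graphs are finite, simple and undirected; $d_G(v)$ denotes degree. $F(G)=\sum_{v\in V(G)}d_G(v)^3$ and $M_1(G)=\sum_{v\in V(G)}d_G(v)^2$. The subdivision graph $S(G)$ is obtained from $G$ by replacing each edge by a path of length two; its vertex set is $V(G)\cup E(G)$. For an operation $\Phi\in\{S,R,Q,T\}$, the $\Phi$-sum $G+_\Phi H$ is the graph with vertex set $(V(G)\cup E(G))\times V(H)$ in which $(u,v)$ and $(u',v')$ are adjacent if and only if [$u=u'\in V(G)$ and $vv'\in E(H)$] or [$v=v'$ and $uu'\in E(\Phi(G))$]. *)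

theory Defs
  imports "Graph_Theory.Digraph_Component"
begin

text \<open>
  Finite simple undirected graphs are rendered by the locale \<^term>\<open>pair_graph\<close>: an undirected
  edge between \<open>u\<close> and \<open>v\<close> is represented by the two arcs \<open>(u, v)\<close> and \<open>(v, u)\<close>. Hence
  \<^term>\<open>card (parcs G)\<close> is twice the number of edges, whereas the set \<open>edges G\<close> below
  contains each edge once. By symmetry, the degree of a vertex is its out-degree.
\<close>

definition edges :: "'a pair_pre_digraph \<Rightarrow> 'a set set" where
  "edges G = {{u, v} | u v. (u, v) \<in> parcs G}"

abbreviation deg :: "'a pair_pre_digraph \<Rightarrow> 'a \<Rightarrow> nat" where
  "deg G v \<equiv> out_degree (with_proj G) v"

definition F_index :: "'a pair_pre_digraph \<Rightarrow> nat" where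
  "F_index G = (\<Sum>v\<in>pverts G. deg G v ^ 3)"

definition M1_index :: "'a pair_pre_digraph \<Rightarrow> nat" where
  "M1_index G = (\<Sum>v\<in>pverts G. deg G v ^ 2)"

text \<open>
  The union of \<open>V(G)\<close> and \<open>E(G)\<close> is the disjoint sum: \<open>Inl u\<close> is the original vertex \<open>u\<close>, and
  \<open>Inr e\<close> is the new vertex placed in the middle of the edge \<open>e\<close>.
\<close>

definition subdivision_graph :: "'a pair_pre_digraph \<Rightarrow> ('a + 'a set) pair_pre_digraph" where
  "subdivision_graph G = \<lparr>
     pverts = pverts G <+> edges G,
     parcs = {(Inl u, Inr e) | u e. e \<in> edges G \<and> u \<in> e}
           \<union> {(Inr e, Inl u) | u e. e \<in> edges G \<and> u \<in> e}\<rparr>"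

text \<open>
  The argument \<open>\<Phi>\<close> is an operation, such as \<^const>\<open>subdivision_graph\<close>, that maps \<open>G\<close> to a graph
  on the union of \<open>V(G)\<close> and \<open>E(G)\<close>.
\<close>

definition graph_sum ::
  "('a pair_pre_digraph \<Rightarrow> ('a + 'a set) pair_pre_digraph) \<Rightarrow> 'a pair_pre_digraph
    \<Rightarrow> 'b pair_pre_digraph \<Rightarrow> (('a + 'a set) \<times> 'b) pair_pre_digraph" where
  "graph_sum \<Phi> G H = \<lparr>
     pverts = (pverts G <+> edges G) \<times> pverts H,
     parcs = {((u, v), (u', v')) | u v u' v'.
       (u, v) \<in> (pverts G <+> edges G) \<times> pverts H \<and>
       (u', v') \<in> (pverts G <+> edges G) \<times> pverts H \<and>
       (u = u' \<and> u \<in> Inl ` pverts G \<and> (v, v') \<in> parcs H \<or>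
        v = v' \<and> (u, u') \<in> parcs (\<Phi> G))}\<rparr>"

lemma finite_edges:
  assumes "pair_graph G"
  shows "finite (edges G)"
proof -
  interpret pair_graph G by fact
  have "edges G = (\<lambda>(u, v). {u, v}) ` parcs G"
    by (auto simp: edges_def)
  then show ?thesis
    using pair_finite_arcs by simp
qed

lemma pair_graph_subdivision_graph:
  assumes "pair_graph G"
  shows "pair_graph (subdivision_graph G)"
proof -
  interpret pair_graph G by fact
  have sub: "u \<in> pverts G" if "e \<in> edges G" "u \<in> e" for u e
    using that by (auto simp: edges_def dest: in_arcsD1 in_arcsD2)
  have fin: "finite (pverts (subdivision_graph G))"
    using pair_finite_verts finite_edges[OF assms] by (simp add: subdivision_graph_def)
  have arcs: "parcs (subdivision_graph G)
      \<subseteq> pverts (subdivision_graph G) \<times> pverts (subdivision_graph G)"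
    using sub by (auto simp: subdivision_graph_def)
  show ?thesis
  proof
    show "finite (parcs (subdivision_graph G))"
      using finite_subset[OF arcs] fin by blast
    show "symmetric (with_proj (subdivision_graph G))"
      by (auto simp: symmetric_def subdivision_graph_def intro!: symI)
  qed (use fin sub in \<open>auto simp: subdivision_graph_def\<close>)
qed

lemma pair_graph_graph_sum:
  assumes "pair_graph G" "pair_graph H" "pair_graph (\<Phi> G)"
  shows "pair_graph (graph_sum \<Phi> G H)"
proof -
  interpret G: pair_graph G by fact
  interpret H: pair_graph H by fact
  interpret P: pair_graph "\<Phi> G" by fact
  have fin: "finite (pverts (graph_sum \<Phi> G H))"
    using G.pair_finite_verts H.pair_finite_verts finite_edges[OF assms(1)]
    by (simp add: graph_sum_def)
  have arcs: "parcs (graph_sum \<Phi> G H)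
      \<subseteq> pverts (graph_sum \<Phi> G H) \<times> pverts (graph_sum \<Phi> G H)"
    by (auto simp: graph_sum_def)
  show ?thesis
  proof
    show "finite (parcs (graph_sum \<Phi> G H))"
      using finite_subset[OF arcs] fin by blast
    show "symmetric (with_proj (graph_sum \<Phi> G H))"
      using H.arcs_symmetric P.arcs_symmetric
      by (auto simp: symmetric_def graph_sum_def intro!: symI)
    show "fst e \<noteq> snd e" if "e \<in> parcs (graph_sum \<Phi> G H)" for e
      using that H.no_loops' P.no_loops' by (fastforce simp: graph_sum_def)
  qed (use fin arcs in auto)
qed

end

theory Submission
  imports Defs
begin

text \<open>The vertices of the sum are of two kinds, and each has an explicit degree. An original
  vertex \<open>(Inl u, v)\<close> has degree \<open>deg G u + deg H v\<close>
  (\<open>deg_graph_sum_Inl\<close>); an edge vertex \<open>(Inr e, v)\<close> has degree 2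
  (\<open>deg_graph_sum_Inr\<close>). The latter contribute 8 each. For the former, expand the cube
  of the sum: the pure cubes give the F-indices, each weighted by the order of the other graph, and
  each mixed term factors into a first Zagreb index times a degree sum, which the handshake lemma
  \<open>sum_deg\<close> evaluates.\<close>

lemma deg_conv_card: "deg G v = card {w. (v, w) \<in> parcs G}"
proof -
  have "out_arcs (with_proj G) v = Pair v ` {w. (v, w) \<in> parcs G}"
    by (auto simp: out_arcs_def)
  then show ?thesis
    by (simp add: out_degree_def card_image inj_on_def)
qed

text \<open>Sending a neighbour \<open>w\<close> to \<open>{v, w}\<close> is a bijection onto the
  edges at \<open>v\<close>. In this form the degree counts the neighbours of \<open>v\<close> in
  the subdivision graph, and it suits double counting.\<close>

lemma deg_conv_card_edges:
  assumes "pair_graph G"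
  shows "deg G v = card {e \<in> edges G. v \<in> e}"
proof -
  interpret pair_graph G by fact
  \<comment> \<open>An edge at \<open>v\<close> may come from an arc into \<open>v\<close>; symmetry
    reverses it.\<close>
  have "{e \<in> edges G. v \<in> e} = (\<lambda>w. {v, w}) ` {w. (v, w) \<in> parcs G}"
    using arcs_symmetric by (auto simp: edges_def)
  moreover have "inj_on (\<lambda>w. {v, w}) {w. (v, w) \<in> parcs G}"
    by (auto simp: inj_on_def doubleton_eq_iff)
  ultimately show ?thesis
    by (simp add: deg_conv_card card_image)
qed

lemma edges_subset_pverts:
  assumes "pair_graph G" "e \<in> edges G"
  shows "e \<subseteq> pverts G"
proof -
  interpret pair_graph G by fact
  show ?thesis
    using assms(2) by (auto simp: edges_def dest: in_arcsD1 in_arcsD2)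
qed

lemma card_edge:
  assumes "pair_graph G" "e \<in> edges G"
  shows "card e = 2"
proof -
  interpret pair_graph G by fact
  show ?thesis
    using assms(2) no_loops' by (fastforce simp: edges_def)
qed

text \<open>Handshake lemma: count incident vertex-edge pairs in two ways, each edge having exactly
  two ends.\<close>

lemma sum_deg:
  assumes "pair_graph G"
  shows "(\<Sum>v\<in>pverts G. deg G v) = 2 * card (edges G)"
proof -
  interpret pair_graph G by fact
  have "card {v \<in> pverts G. v \<in> e} = 2" if "e \<in> edges G" for e
  proof -
    have "{v \<in> pverts G. v \<in> e} = e"
      using edges_subset_pverts[OF assms that] by blast
    then show ?thesis
      by (simp add: card_edge[OF assms that])
  qed
  then show ?thesis
    by (simp add: deg_conv_card_edges[OF assms] sum_multicount finite_edges[OF assms])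
qed

text \<open>A neighbour arises either by moving to the midpoint of an edge at \<open>u\<close>
  within layer \<open>v\<close>, or by moving along an arc of \<open>H\<close> with
  \<open>Inl u\<close> fixed. The tags \<open>Inr\<close> and \<open>Inl\<close> keep the two sets
  apart, so their sizes add.\<close>

lemma deg_graph_sum_Inl:
  assumes "pair_graph G" "pair_graph H" "u \<in> pverts G" "v \<in> pverts H"
  shows "deg (graph_sum subdivision_graph G H) (Inl u, v) = deg G u + deg H v"
proof -
  interpret H: pair_graph H by fact
  let ?A = "{e \<in> edges G. u \<in> e}" and ?B = "{w. (v, w) \<in> parcs H}"
  have "{w. ((Inl u, v), w) \<in> parcs (graph_sum subdivision_graph G H)} =
      (\<lambda>e. (Inr e, v)) ` ?A \<union> Pair (Inl u) ` ?B"
    using assms(3,4) by (auto simp: graph_sum_def subdivision_graph_def dest: H.in_arcsD2)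
  moreover have "finite ?A"
    using finite_edges[OF assms(1)] by simp
  moreover have "finite ?B"
    by (rule finite_subset[OF _ H.pair_finite_verts]) (auto dest: H.in_arcsD2)
  moreover have "card ((\<lambda>e. (Inr e :: 'a + 'a set, v)) ` ?A) = card ?A"
    by (rule card_image) (simp add: inj_on_def)
  moreover have "card (Pair (Inl u :: 'a + 'a set) ` ?B) = card ?B"
    by (rule card_image) (simp add: inj_on_def)
  moreover have "(\<lambda>e. (Inr e :: 'a + 'a set, v)) ` ?A \<inter> Pair (Inl u) ` ?B = {}"
    by auto
  ultimately show ?thesis
    unfolding deg_conv_card[of "graph_sum subdivision_graph G H"] deg_conv_card[of H]
      deg_conv_card_edges[OF assms(1)]
    by (simp add: card_Un_disjoint)
qed

text \<open>Arcs of \<open>H\<close> are copied only over original vertices, so an edge vertex sees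
  just the two ends of \<open>e\<close> in its own layer.\<close>

lemma deg_graph_sum_Inr:
  assumes "pair_graph G" "e \<in> edges G" "v \<in> pverts H"
  shows "deg (graph_sum subdivision_graph G H) (Inr e, v) = 2"
proof -
  have "{w. ((Inr e, v), w) \<in> parcs (graph_sum subdivision_graph G H)} =
      (\<lambda>u. (Inl u, v)) ` e"
    using assms(2,3) edges_subset_pverts[OF assms(1,2)]
    by (auto simp: graph_sum_def subdivision_graph_def)
  then show ?thesis
    by (simp add: deg_conv_card card_image inj_on_def card_edge[OF assms(1,2)])
qed

theorem theorem2:
  fixes G :: "'a pair_pre_digraph" and H :: "'b pair_pre_digraph"
  assumes "pair_graph G" and "connected (with_proj G)" and "card (pverts G) \<ge> 2"
    and "pair_graph H" and "connected (with_proj H)"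
  shows "F_index (graph_sum subdivision_graph G H) =
      card (pverts H) * F_index G + card (pverts G) * F_index H
      + 6 * card (edges H) * M1_index G + 6 * card (edges G) * M1_index H
      + 8 * card (pverts H) * card (edges G)"
proof -
  interpret G: pair_graph G by fact
  interpret H: pair_graph H by fact
  let ?d = "deg (graph_sum subdivision_graph G H)"
  \<comment> \<open>The coefficient 3 stays outside the mixed products, so that their double sums
    match \<open>sum_product\<close> below.\<close>
  have cube: "(a + b) ^ 3 = a ^ 3 + b ^ 3 + 3 * (a ^ 2 * b) + 3 * (a * b ^ 2)" for a b :: nat
    by (simp add: power3_eq_cube power2_eq_square algebra_simps)
  have "F_index (graph_sum subdivision_graph G H) =
      (\<Sum>x\<in>pverts G <+> edges G. \<Sum>v\<in>pverts H. ?d (x, v) ^ 3)"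
    by (simp add: F_index_def graph_sum_def sum.cartesian_product)
  also have "\<dots> = (\<Sum>u\<in>pverts G. \<Sum>v\<in>pverts H. ?d (Inl u, v) ^ 3)
      + (\<Sum>e\<in>edges G. \<Sum>v\<in>pverts H. ?d (Inr e, v) ^ 3)"
    by (simp add: sum.Plus finite_edges[OF assms(1)])
  \<comment> \<open>The factor 8 is the cube of the degree 2.\<close>
  also have "(\<Sum>e\<in>edges G. \<Sum>v\<in>pverts H. ?d (Inr e, v) ^ 3) =
      8 * card (pverts H) * card (edges G)"
    by (simp add: deg_graph_sum_Inr[OF assms(1)])
  also have "(\<Sum>u\<in>pverts G. \<Sum>v\<in>pverts H. ?d (Inl u, v) ^ 3) =
      (\<Sum>u\<in>pverts G. \<Sum>v\<in>pverts H. (deg G u + deg H v) ^ 3)"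
    by (simp add: deg_graph_sum_Inl[OF assms(1,4)])
  also have "\<dots> = card (pverts H) * F_index G + card (pverts G) * F_index H
      + 3 * (M1_index G * (\<Sum>v\<in>pverts H. deg H v))
      + 3 * ((\<Sum>u\<in>pverts G. deg G u) * M1_index H)"
    by (simp add: cube sum.distrib F_index_def M1_index_def sum_product
        flip: sum_distrib_left)
  \<comment> \<open>Each degree sum is twice the number of edges, which turns the coefficients 3
    into 6.\<close>
  finally show ?thesis
    by (simp add: sum_deg assms(1,4) algebra_simps)
qed

end
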